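(* The functor $\tau\colon \Delta_{\mathbb{F}}^1\to\Omega$ preserves the surjective-injective and active-inert factorization systems.
   Context: $\Delta_{\mathbb{F}}^1$ is the full subcategory of Barwick's category $\Delta_{\mathbb{F}}$ (objects $([n], f\colon[n]\to\mathbb{F})$, $\mathbb{F}$ finite sets; morphisms $(\phi,\eta)$ with $\phi$ in $\Delta$, $\eta\colon f\to g\circ\phi$ with injective components and pullback naturality squares) on objects with $f(n)=\mathbf{1}$. A map $(\phi,\eta)$ is injective if $\phi$ is injective; surjective if $\phi$ is surjective and all $\eta_i$ are bijections; inert if $\phi$ is the inclusion of a subinterval; active if $\phi$ preserves endpoints and all $\eta_i$ are bijections. $\Omega$ is the dendroidal category (trees as polynomial endofunctors, per Kock), where inert maps are embeddings of subtrees and active maps send leaves bijectively to leaves and root to root. $\tau$ sends $([n],f)$ to the tree with edges $\coprod_{i=0}^n f(i)$ and vertices $\coprod_{i=1}^n f(i)$, the edge $x\in f(i)$ ($i<n$) entering the vertex $f^{i(i+1)}(x)$, and is determined on morphisms by the edge map given on $f(i)$ by $\eta_i\colon f(i)\to g(\phi(i))$. *)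

theory Defs
  imports Main
begin

text \<open>An object ([n], f : [n] -> F) of Delta_F: a functor from the poset [n] to finite
  sets is given by finite sets f(0),...,f(n) together with maps f(i) -> f(i+1).\<close>

record 'a dobj =
  dim :: nat
  fib :: "nat \<Rightarrow> 'a set"
  tr  :: "nat \<Rightarrow> 'a \<Rightarrow> 'a"

definition dF_obj :: "'a dobj \<Rightarrow> bool" where
  "dF_obj X \<longleftrightarrow> (\<forall>i\<le>dim X. finite (fib X i))
      \<and> (\<forall>i<dim X. tr X i ` fib X i \<subseteq> fib X (Suc i))"

definition dF1_obj :: "'a dobj \<Rightarrow> bool" where
  "dF1_obj X \<longleftrightarrow> dF_obj X \<and> (\<exists>u. fib X (dim X) = {u})"

fun fmap :: "'a dobj \<Rightarrow> nat \<Rightarrow> nat \<Rightarrow> 'a \<Rightarrow> 'a" where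
  "fmap X i 0 x = x"
| "fmap X i (Suc k) x = tr X (i + k) (fmap X i k x)"

definition fij :: "'a dobj \<Rightarrow> nat \<Rightarrow> nat \<Rightarrow> 'a \<Rightarrow> 'a" where
  "fij X i j = fmap X i (j - i)"

text \<open>A morphism (phi, eta) : X -> Y of Delta_F: phi : [m] -> [n] monotone,
  eta_i : f(i) -> g(phi i) injective, natural, with pullback naturality squares.
  (Naturality / pullback for consecutive squares; the general squares are composites.)\<close>
definition dF_mor :: "'a dobj \<Rightarrow> 'a dobj \<Rightarrow> (nat \<Rightarrow> nat) \<Rightarrow> (nat \<Rightarrow> 'a \<Rightarrow> 'a) \<Rightarrow> bool" where
  "dF_mor X Y \<phi> \<eta> \<longleftrightarrow>
     (\<forall>i\<le>dim X. \<phi> i \<le> dim Y)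
   \<and> (\<forall>i j. i \<le> j \<and> j \<le> dim X \<longrightarrow> \<phi> i \<le> \<phi> j)
   \<and> (\<forall>i\<le>dim X. \<eta> i ` fib X i \<subseteq> fib Y (\<phi> i) \<and> inj_on (\<eta> i) (fib X i))
   \<and> (\<forall>i<dim X. \<forall>x\<in>fib X i.
        \<eta> (Suc i) (tr X i x) = fij Y (\<phi> i) (\<phi> (Suc i)) (\<eta> i x))
   \<and> (\<forall>i<dim X. bij_betw (\<lambda>x. (tr X i x, \<eta> i x)) (fib X i)
        {(x', y). x' \<in> fib X (Suc i) \<and> y \<in> fib Y (\<phi> i)
                 \<and> \<eta> (Suc i) x' = fij Y (\<phi> i) (\<phi> (Suc i)) y})"

definition dF_injective :: "'a dobj \<Rightarrow> 'a dobj \<Rightarrow> (nat \<Rightarrow> nat) \<Rightarrow> (nat \<Rightarrow> 'a \<Rightarrow> 'a) \<Rightarrow> bool" where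
  "dF_injective X Y \<phi> \<eta> \<longleftrightarrow> inj_on \<phi> {0..dim X}"

definition dF_surjective :: "'a dobj \<Rightarrow> 'a dobj \<Rightarrow> (nat \<Rightarrow> nat) \<Rightarrow> (nat \<Rightarrow> 'a \<Rightarrow> 'a) \<Rightarrow> bool" where
  "dF_surjective X Y \<phi> \<eta> \<longleftrightarrow> \<phi> ` {0..dim X} = {0..dim Y}
      \<and> (\<forall>i\<le>dim X. bij_betw (\<eta> i) (fib X i) (fib Y (\<phi> i)))"

definition dF_inert :: "'a dobj \<Rightarrow> 'a dobj \<Rightarrow> (nat \<Rightarrow> nat) \<Rightarrow> (nat \<Rightarrow> 'a \<Rightarrow> 'a) \<Rightarrow> bool" where
  "dF_inert X Y \<phi> \<eta> \<longleftrightarrow> (\<exists>k. \<forall>i\<le>dim X. \<phi> i = i + k)"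

definition dF_active :: "'a dobj \<Rightarrow> 'a dobj \<Rightarrow> (nat \<Rightarrow> nat) \<Rightarrow> (nat \<Rightarrow> 'a \<Rightarrow> 'a) \<Rightarrow> bool" where
  "dF_active X Y \<phi> \<eta> \<longleftrightarrow> \<phi> 0 = 0 \<and> \<phi> (dim X) = dim Y
      \<and> (\<forall>i\<le>dim X. bij_betw (\<eta> i) (fib X i) (fib Y (\<phi> i)))"

record ('e, 'v) tree =
  edges :: "'e set"
  verts :: "'v set"
  out   :: "'v \<Rightarrow> 'e"
  inp   :: "'v \<Rightarrow> 'e set"

definition is_leaf :: "('e, 'v) tree \<Rightarrow> 'e \<Rightarrow> bool" where
  "is_leaf T e \<longleftrightarrow> e \<in> edges T \<and> (\<forall>v\<in>verts T. out T v \<noteq> e)"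

definition is_root :: "('e, 'v) tree \<Rightarrow> 'e \<Rightarrow> bool" where
  "is_root T e \<longleftrightarrow> e \<in> edges T \<and> (\<forall>v\<in>verts T. e \<notin> inp T v)"

text \<open>Classes of morphisms of Omega, expressed on the edge map h : S -> T
  (a morphism of Omega is determined by its map on edges).\<close>

definition om_injective :: "('e, 'v) tree \<Rightarrow> ('f, 'w) tree \<Rightarrow> ('e \<Rightarrow> 'f) \<Rightarrow> bool" where
  "om_injective S T h \<longleftrightarrow> inj_on h (edges S)"

definition om_surjective :: "('e, 'v) tree \<Rightarrow> ('f, 'w) tree \<Rightarrow> ('e \<Rightarrow> 'f) \<Rightarrow> bool" where
  "om_surjective S T h \<longleftrightarrow> h ` edges S = edges T"

definition om_active :: "('e, 'v) tree \<Rightarrow> ('f, 'w) tree \<Rightarrow> ('e \<Rightarrow> 'f) \<Rightarrow> bool" where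
  "om_active S T h \<longleftrightarrow> bij_betw h {e. is_leaf S e} {e. is_leaf T e}
      \<and> (\<forall>e. is_root S e \<longrightarrow> is_root T (h e))"

definition om_inert :: "('e, 'v) tree \<Rightarrow> ('f, 'w) tree \<Rightarrow> ('e \<Rightarrow> 'f) \<Rightarrow> bool" where
  "om_inert S T h \<longleftrightarrow> inj_on h (edges S)
      \<and> (\<exists>k. \<forall>v\<in>verts S. k v \<in> verts T \<and> out T (k v) = h (out S v)
                          \<and> inp T (k v) = h ` inp S v)"

definition tau :: "'a dobj \<Rightarrow> (nat \<times> 'a, nat \<times> 'a) tree" where
  "tau X = \<lparr> edges = {(i, x). i \<le> dim X \<and> x \<in> fib X i},
             verts = {(i, x). 1 \<le> i \<and> i \<le> dim X \<and> x \<in> fib X i},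
             out = (\<lambda>v. v),
             inp = (\<lambda>(i, y). {(i - 1, x) | x. x \<in> fib X (i - 1) \<and> tr X (i - 1) x = y}) \<rparr>"

definition tau_mor :: "(nat \<Rightarrow> nat) \<Rightarrow> (nat \<Rightarrow> 'a \<Rightarrow> 'a) \<Rightarrow> nat \<times> 'a \<Rightarrow> nat \<times> 'a" where
  "tau_mor \<phi> \<eta> = (\<lambda>(i, x). (\<phi> i, \<eta> i x))"

end

theory Submission
  imports Defs
begin

text \<open>Leaves of \<open>\<tau>(X)\<close> are the edges in \<open>f(0)\<close> and roots those in \<open>f(n)\<close>, since every other
  edge is an input of the vertex above it; so an active map, which preserves both endpoints and
  is bijective on fibres, sends leaves bijectively to leaves and roots to roots. Surjectivity and
  injectivity are read off directly on edges, and for an inert map the pullback squares identify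
  the inputs of each image vertex with the images of the inputs.\<close>

lemma tau_simps:
  "edges (tau X) = {(i, x). i \<le> dim X \<and> x \<in> fib X i}"
  "verts (tau X) = {(i, x). 1 \<le> i \<and> i \<le> dim X \<and> x \<in> fib X i}"
  "out (tau X) = (\<lambda>v. v)"
  "inp (tau X) (i, y) = {(i - 1, x) | x. x \<in> fib X (i - 1) \<and> tr X (i - 1) x = y}"
  by (simp_all add: tau_def)

lemma tau_mor_apply [simp]: "tau_mor \<phi> \<eta> (i, x) = (\<phi> i, \<eta> i x)"
  by (simp add: tau_mor_def)

lemma fij_Suc [simp]: "fij X i (Suc i) = tr X i"
  by (simp add: fij_def fun_eq_iff)

lemma leaves_tau: "{e. is_leaf (tau X) e} = Pair 0 ` fib X 0"
proof -
  have "is_leaf (tau X) (i, x) \<longleftrightarrow> i = 0 \<and> x \<in> fib X 0" for i x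
    by (cases i) (auto simp: is_leaf_def tau_simps)
  then show ?thesis
    by auto
qed

lemma is_root_tau:
  assumes "dF_obj X"
  shows "is_root (tau X) (i, x) \<longleftrightarrow> i = dim X \<and> x \<in> fib X (dim X)"
proof
  assume root: "is_root (tau X) (i, x)"
  then have ix: "i \<le> dim X" "x \<in> fib X i"
    by (auto simp: is_root_def tau_simps)
  have "i = dim X"
  proof (rule ccontr)
    assume "i \<noteq> dim X"
    with ix have "i < dim X"
      by simp
    with assms ix have "(Suc i, tr X i x) \<in> verts (tau X)"
      by (auto simp: dF_obj_def tau_simps)
    moreover have "(i, x) \<in> inp (tau X) (Suc i, tr X i x)"
      using ix by (simp add: tau_simps)
    ultimately show False
      using root by (auto simp: is_root_def)
  qed
  with ix show "i = dim X \<and> x \<in> fib X (dim X)"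
    by simp
qed (auto simp: is_root_def tau_simps)

lemma tau_mor_surjective:
  assumes "dF_surjective X Y \<phi> \<eta>"
  shows "om_surjective (tau X) (tau Y) (tau_mor \<phi> \<eta>)"
proof -
  have phi: "\<phi> ` {0..dim X} = {0..dim Y}"
    and eta: "\<And>i. i \<le> dim X \<Longrightarrow> \<eta> i ` fib X i = fib Y (\<phi> i)"
    using assms by (auto simp: dF_surjective_def bij_betw_def)
  have "(j, y) \<in> tau_mor \<phi> \<eta> ` edges (tau X)" if "j \<le> dim Y" "y \<in> fib Y j" for j y
  proof -
    from phi that(1) obtain i where i: "i \<le> dim X" "\<phi> i = j"
      by (metis atLeastAtMost_iff imageE zero_le)
    with eta that(2) have "y \<in> \<eta> i ` fib X i"
      by simp
    then obtain x where "x \<in> fib X i" "y = \<eta> i x"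
      by blast
    with i have "(i, x) \<in> edges (tau X)" "(j, y) = tau_mor \<phi> \<eta> (i, x)"
      by (simp_all add: tau_simps)
    then show ?thesis
      by blast
  qed
  moreover have "tau_mor \<phi> \<eta> e \<in> edges (tau Y)" if "e \<in> edges (tau X)" for e
  proof -
    from that obtain i x where e: "e = (i, x)" "i \<le> dim X" "x \<in> fib X i"
      by (auto simp: tau_simps)
    then have "\<phi> i \<in> {0..dim Y}" "\<eta> i x \<in> fib Y (\<phi> i)"
      using phi eta[of i] by auto
    with e show ?thesis
      by (simp add: tau_simps)
  qed
  ultimately show ?thesis
    unfolding om_surjective_def by (auto simp: tau_simps)
qed

lemma tau_mor_injective:
  assumes "dF_mor X Y \<phi> \<eta>" and "dF_injective X Y \<phi> \<eta>"
  shows "om_injective (tau X) (tau Y) (tau_mor \<phi> \<eta>)"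
proof -
  have phi: "inj_on \<phi> {0..dim X}"
    and eta: "\<And>i. i \<le> dim X \<Longrightarrow> inj_on (\<eta> i) (fib X i)"
    using assms by (auto simp: dF_mor_def dF_injective_def)
  show ?thesis
    unfolding om_injective_def
  proof (rule inj_onI)
    fix a b
    assume "a \<in> edges (tau X)" "b \<in> edges (tau X)" and eq: "tau_mor \<phi> \<eta> a = tau_mor \<phi> \<eta> b"
    then obtain i x j y where a: "a = (i, x)" "i \<le> dim X" "x \<in> fib X i"
      and b: "b = (j, y)" "j \<le> dim X" "y \<in> fib X j"
      by (auto simp: tau_simps)
    with eq phi have "i = j"
      by (auto dest: inj_onD)
    with a b eq eta[of i] show "a = b"
      by (auto dest: inj_onD)
  qed
qed

lemma tau_mor_active:
  assumes X: "dF_obj X" and Y: "dF_obj Y" and "dF_active X Y \<phi> \<eta>"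
  shows "om_active (tau X) (tau Y) (tau_mor \<phi> \<eta>)"
proof -
  have bottom: "\<phi> 0 = 0" and top: "\<phi> (dim X) = dim Y"
    and bij: "\<And>i. i \<le> dim X \<Longrightarrow> bij_betw (\<eta> i) (fib X i) (fib Y (\<phi> i))"
    using assms(3) by (auto simp: dF_active_def)
  from bij[of 0] bottom have eta0: "bij_betw (\<eta> 0) (fib X 0) (fib Y 0)"
    by simp
  have "tau_mor \<phi> \<eta> ` Pair 0 ` fib X 0 = Pair 0 ` \<eta> 0 ` fib X 0"
    using bottom by (force simp: image_iff)
  moreover have "inj_on (tau_mor \<phi> \<eta>) (Pair 0 ` fib X 0)"
    using eta0 by (auto simp: bij_betw_def inj_on_def)
  ultimately have leaves: "bij_betw (tau_mor \<phi> \<eta>) (Pair 0 ` fib X 0) (Pair 0 ` fib Y 0)"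
    using eta0 by (simp add: bij_betw_def)
  have "is_root (tau Y) (tau_mor \<phi> \<eta> e)" if "is_root (tau X) e" for e
  proof -
    from that obtain x where "e = (dim X, x)" "x \<in> fib X (dim X)"
      using is_root_tau[OF X] by (cases e) auto
    moreover from this bij[of "dim X"] top have "\<eta> (dim X) x \<in> fib Y (dim Y)"
      by (metis bij_betwE order_refl)
    ultimately show ?thesis
      using top by (simp add: is_root_tau[OF Y])
  qed
  with leaves show ?thesis
    by (simp add: om_active_def leaves_tau)
qed

lemma dF_inert_imp_injective: "dF_inert X Y \<phi> \<eta> \<Longrightarrow> dF_injective X Y \<phi> \<eta>"
  by (auto simp: dF_inert_def dF_injective_def inj_on_def)

lemma tau_mor_inp:
  assumes mor: "dF_mor X Y \<phi> \<eta>" and i: "i < dim X" and step: "\<phi> (Suc i) = Suc (\<phi> i)"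
    and x: "x \<in> fib X (Suc i)"
  shows "inp (tau Y) (tau_mor \<phi> \<eta> (Suc i, x)) = tau_mor \<phi> \<eta> ` inp (tau X) (Suc i, x)"
proof -
  have into: "\<eta> i ` fib X i \<subseteq> fib Y (\<phi> i)"
    and nat: "\<And>x'. x' \<in> fib X i \<Longrightarrow> \<eta> (Suc i) (tr X i x') = tr Y (\<phi> i) (\<eta> i x')"
    and pb: "(\<lambda>x'. (tr X i x', \<eta> i x')) ` fib X i =
        {(x', y). x' \<in> fib X (Suc i) \<and> y \<in> fib Y (\<phi> i) \<and> \<eta> (Suc i) x' = tr Y (\<phi> i) y}"
    using mor i step by (auto simp: dF_mor_def bij_betw_def)
  have "(\<phi> i, y) \<in> tau_mor \<phi> \<eta> ` inp (tau X) (Suc i, x)"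
    if "y \<in> fib Y (\<phi> i)" "tr Y (\<phi> i) y = \<eta> (Suc i) x" for y
  proof -
    from that x have "(x, y) \<in> (\<lambda>x'. (tr X i x', \<eta> i x')) ` fib X i"
      unfolding pb by simp
    then obtain x' where "x' \<in> fib X i" "tr X i x' = x" "\<eta> i x' = y"
      by auto
    then have "(i, x') \<in> inp (tau X) (Suc i, x)" "(\<phi> i, y) = tau_mor \<phi> \<eta> (i, x')"
      by (simp_all add: tau_simps)
    then show ?thesis
      by blast
  qed
  then show ?thesis
    using into nat step by (auto simp: tau_simps)
qed

lemma tau_mor_inert:
  assumes mor: "dF_mor X Y \<phi> \<eta>" and inert: "dF_inert X Y \<phi> \<eta>"
  shows "om_inert (tau X) (tau Y) (tau_mor \<phi> \<eta>)"
proof -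
  obtain k where k: "\<And>i. i \<le> dim X \<Longrightarrow> \<phi> i = i + k"
    using inert by (auto simp: dF_inert_def)
  have maps: "\<And>i. i \<le> dim X \<Longrightarrow> \<phi> i \<le> dim Y \<and> \<eta> i ` fib X i \<subseteq> fib Y (\<phi> i)"
    using mor by (auto simp: dF_mor_def)
  have "tau_mor \<phi> \<eta> v \<in> verts (tau Y)
      \<and> inp (tau Y) (tau_mor \<phi> \<eta> v) = tau_mor \<phi> \<eta> ` inp (tau X) v"
    if "v \<in> verts (tau X)" for v
  proof -
    from that obtain j x where v: "v = (j, x)" "1 \<le> j" "j \<le> dim X" "x \<in> fib X j"
      by (auto simp: tau_simps)
    define i where "i = j - 1"
    with v have i: "j = Suc i" "i < dim X"
      by simp_all
    with k have "\<phi> (Suc i) = Suc (\<phi> i)"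
      by simp
    from tau_mor_inp[OF mor i(2) this] i v
    have "inp (tau Y) (tau_mor \<phi> \<eta> v) = tau_mor \<phi> \<eta> ` inp (tau X) v"
      by simp
    moreover have "tau_mor \<phi> \<eta> v \<in> verts (tau Y)"
      using v maps[of j] k[of j] by (auto simp: tau_simps)
    ultimately show ?thesis
      by simp
  qed
  moreover have "inj_on (tau_mor \<phi> \<eta>) (edges (tau X))"
    using tau_mor_injective[OF mor dF_inert_imp_injective[OF inert]]
    by (simp add: om_injective_def)
  ultimately show ?thesis
    unfolding om_inert_def by (intro conjI exI[of _ "tau_mor \<phi> \<eta>"]) (simp_all add: tau_simps(3))
qed

theorem lemma4p4:
  fixes X Y :: "'a dobj" and \<phi> :: "nat \<Rightarrow> nat" and \<eta> :: "nat \<Rightarrow> 'a \<Rightarrow> 'a"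
  assumes "dF1_obj X" and "dF1_obj Y" and "dF_mor X Y \<phi> \<eta>"
  shows "(dF_surjective X Y \<phi> \<eta> \<longrightarrow> om_surjective (tau X) (tau Y) (tau_mor \<phi> \<eta>))
       \<and> (dF_injective X Y \<phi> \<eta> \<longrightarrow> om_injective (tau X) (tau Y) (tau_mor \<phi> \<eta>))
       \<and> (dF_active X Y \<phi> \<eta> \<longrightarrow> om_active (tau X) (tau Y) (tau_mor \<phi> \<eta>))
       \<and> (dF_inert X Y \<phi> \<eta> \<longrightarrow> om_inert (tau X) (tau Y) (tau_mor \<phi> \<eta>))"
proof -
  from assms(1,2) have "dF_obj X" "dF_obj Y"
    by (simp_all add: dF1_obj_def)
  with assms(3) show ?thesis
    using tau_mor_surjective tau_mor_injective tau_mor_active tau_mor_inert by blast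
qed

end
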